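(* Let $\Lambda=\{1,\dots,N\}$, let $X_i\subseteq\mathbb{R}^{n_i}$, $K_i:X\rightrightarrows\mathbb{R}^{n_i}$ and $P_i:\mathbb{R}^n\rightrightarrows\mathbb{R}^{n_i}$ ($i\in\Lambda$), where $n=\sum_{i\in\Lambda}n_i$ and $X=\prod_{i\in\Lambda}X_i$, and let $K:X\rightrightarrows\mathbb{R}^n$ be $K(x)=\prod_{i\in\Lambda}K_i(x)$. Assume that for every $i\in\Lambda$: (a) $X_i\subset\mathbb{R}^{n_i}$ is non-empty, compact and convex; (b) $K_i$ is a closed, lower semi-continuous map such that $K_i(x)$ is non-empty and convex for every $x\in X$; (c) $P_i$ is a lower semi-continuous map; (d) $P_i(y)$ is an open set and $y_i\notin co(P_i(y))$ for every $y\in\prod_{j\in\Lambda}co(\overline{K_j(X)})$. If $K(X)$ is relatively compact, then the generalized Nash game $\Gamma=(X_i,K_i,P_i)_{i\in\Lambda}$ admits a projected solution.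
   Context: $n_i\ge 1$ are integers; spaces carry the Euclidean norm. $A\rightrightarrows B$ denotes a multi-valued map (each point of $A$ is sent to a possibly empty subset of $B$). A multi-valued map is closed if its graph is closed in the product of its domain and target space. $co$ denotes convex hull, an overline denotes closure, $K_i(X)=\bigcup_{x\in X}K_i(x)$ and $K(X)=\bigcup_{x\in X}K(x)$. A vector $y\in\mathbb{R}^n$ is written $y=(y_i)_{i\in\Lambda}$ with $y_i\in\mathbb{R}^{n_i}$. Projected solution of $\Gamma=(X_i,K_i,P_i)_{i\in\Lambda}$: a vector $\tilde x\in X$ for which there exists $\tilde y=(\tilde y_i)_{i\in\Lambda}\in\mathbb{R}^n$ such that (i) $\|\tilde y-\tilde x\|=\inf_{w\in X}\|\tilde y-w\|$ and (ii) for every $i\in\Lambda$, $\tilde y_i\in K_i(\tilde x)$ and $P_i(\tilde y)\cap K_i(\tilde x)=\emptyset$. *)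

theory Defs
  imports "HOL-Analysis.Analysis"
begin

text \<open>
  The type \<^typ>\<open>real^'k\<close> plays the role of $R^n$. The map \<open>b\<close> assigns to each of the $n$
  coordinates the player it belongs to, and $R^{n_i}$ is the subspace of the vectors supported on
  the coordinates of player \<open>i\<close>; it carries the induced (Euclidean) norm and topology. Closures and
  convex hulls of subsets of it are the same computed in the subspace or in \<^typ>\<open>real^'k\<close>, but
  openness has to be taken relative to it.
\<close>

definition block_space :: "('k::finite \<Rightarrow> nat) \<Rightarrow> nat \<Rightarrow> (real^'k) set" where
  "block_space b i = {v. \<forall>k. b k \<noteq> i \<longrightarrow> v $ k = 0}"

definition block :: "('k::finite \<Rightarrow> nat) \<Rightarrow> nat \<Rightarrow> real^'k \<Rightarrow> real^'k" where
  "block b i y = (\<chi> k. if b k = i then y $ k else 0)"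

definition block_prod ::
    "('k::finite \<Rightarrow> nat) \<Rightarrow> nat set \<Rightarrow> (nat \<Rightarrow> (real^'k) set) \<Rightarrow> (real^'k) set" where
  "block_prod b \<Lambda> S = {y. \<forall>i\<in>\<Lambda>. block b i y \<in> S i}"

text \<open>The next three facts justify the encoding: the blocks have the intended dimensions, and
  \<^typ>\<open>real^'k\<close> is their orthogonal direct sum, with the Euclidean norm of the product.\<close>

lemma dim_block_space: "dim (block_space b i) = card {k. b k = i}"
proof -
  have "block_space b i = {v. \<forall>k. k \<notin> {k. b k = i} \<longrightarrow> v $ k = 0}"
    by (auto simp: block_space_def)
  then show ?thesis
    using dim_substandard_cart[of "{k. b k = i}", where ?'a = real]
    by (simp add: dim_vec_eq)
qed

lemma sum_block:
  assumes "\<And>k. b k \<in> \<Lambda>" "finite \<Lambda>" "\<And>i. i \<in> \<Lambda> \<Longrightarrow> v i \<in> block_space b i" "j \<in> \<Lambda>"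
  shows "block b j (\<Sum>i\<in>\<Lambda>. v i) = v j" and "(\<Sum>i\<in>\<Lambda>. block b i y) = y"
proof -
  have "(\<Sum>i\<in>\<Lambda>. v i $ k) = v (b k) $ k" for k
    using assms by (subst sum.remove[of _ "b k"]) (auto intro!: sum.neutral simp: block_space_def)
  then show "block b j (\<Sum>i\<in>\<Lambda>. v i) = v j"
    using assms by (auto simp: block_def vec_eq_iff block_space_def)
  show "(\<Sum>i\<in>\<Lambda>. block b i y) = y"
    using assms by (simp add: block_def vec_eq_iff)
qed

lemma norm_block_sum:
  assumes "\<And>k. b k \<in> \<Lambda>" "finite \<Lambda>"
  shows "(norm y)\<^sup>2 = (\<Sum>i\<in>\<Lambda>. (norm (block b i y))\<^sup>2)"
proof -
  have "(norm (block b i y))\<^sup>2 = (\<Sum>k\<in>UNIV. if b k = i then (y $ k)\<^sup>2 else 0)" for i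
    by (auto simp: block_def norm_vec_def L2_set_def sum_nonneg intro!: sum.cong)
  then have "(\<Sum>i\<in>\<Lambda>. (norm (block b i y))\<^sup>2)
      = (\<Sum>k\<in>UNIV. \<Sum>i\<in>\<Lambda>. if b k = i then (y $ k)\<^sup>2 else 0)"
    by (simp add: sum.swap[of _ UNIV])
  also have "\<dots> = (norm y)\<^sup>2"
    using assms by (simp add: norm_vec_def L2_set_def sum_nonneg)
  finally show ?thesis by simp
qed

definition multimap :: "'a set \<Rightarrow> 'b set \<Rightarrow> ('a \<Rightarrow> 'b set) \<Rightarrow> bool" where
  "multimap A B F \<longleftrightarrow> (\<forall>x\<in>A. F x \<subseteq> B)"

definition closed_multimap ::
    "'a::topological_space set \<Rightarrow> 'b::topological_space set \<Rightarrow> ('a \<Rightarrow> 'b set) \<Rightarrow> bool" where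
  "closed_multimap A B F \<longleftrightarrow> closedin (top_of_set (A \<times> B)) {(x, y). x \<in> A \<and> y \<in> F x}"

definition lsc_multimap ::
    "'a::topological_space set \<Rightarrow> 'b::topological_space set \<Rightarrow> ('a \<Rightarrow> 'b set) \<Rightarrow> bool" where
  "lsc_multimap A B F \<longleftrightarrow>
    (\<forall>V. openin (top_of_set B) V \<longrightarrow> openin (top_of_set A) {x \<in> A. F x \<inter> V \<noteq> {}})"

definition projected_solution ::
    "('k::finite \<Rightarrow> nat) \<Rightarrow> nat set \<Rightarrow> (nat \<Rightarrow> (real^'k) set) \<Rightarrow> (nat \<Rightarrow> real^'k \<Rightarrow> (real^'k) set) \<Rightarrow>
     (nat \<Rightarrow> real^'k \<Rightarrow> (real^'k) set) \<Rightarrow> real^'k \<Rightarrow> bool" where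
  "projected_solution b \<Lambda> X K P x \<longleftrightarrow>
    x \<in> block_prod b \<Lambda> X \<and>
    (\<exists>y. norm (y - x) = (INF w \<in> block_prod b \<Lambda> X. norm (y - w)) \<and>
         (\<forall>i\<in>\<Lambda>. block b i y \<in> K i x \<and> P i y \<inter> K i x = {}))"

end

theory Submission
  imports Defs
begin

text \<open>
  The equilibrium is found as a fixed point in \<open>y\<close> alone. Let \<open>Y\<close> be the product of the convex
  hulls of the sets \<open>closure (K\<^sub>i(X))\<close>, which is compact and convex, and let \<open>p\<close> be the
  metric projection onto the compact convex set \<open>X\<close>. It is continuous, and \<open>p y\<close> is by definition
  a point of \<open>X\<close> nearest to \<open>y\<close>. It therefore suffices to find \<open>y \<in> Y\<close> such that, for every player
  \<open>i\<close>, the block \<open>y\<^sub>i\<close> lies in \<open>K\<^sub>i(p y)\<close> and \<open>P\<^sub>i(y)\<close> misses \<open>K\<^sub>i(p y)\<close>; then \<open>x = p y\<close> is a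
  projected solution.

  Following Shafer and Sonnenschein, the preferences are replaced by utilities. The values
  \<open>P\<^sub>i(y)\<close> are open and \<open>P\<^sub>i\<close> is lower semicontinuous. In finite dimension this makes the graph of
  \<open>y \<mapsto> co (P\<^sub>i(y))\<close> relatively open (\<open>openin_graph_convex_hull\<close>), although the graph of \<open>P\<^sub>i\<close> itself
  need not be. So the distance \<open>u\<^sub>i(y, z)\<close> of \<open>(y, z)\<close> to the complement of that graph is a
  continuous function that is positive exactly when \<open>z \<in> co (P\<^sub>i(y))\<close> (\<open>preference_utility\<close>).

  Let \<open>F(y)\<close> be the set of those \<open>z\<close> each of whose blocks \<open>z\<^sub>i\<close> maximises \<open>u\<^sub>i(y, \<cdot>)\<close> over
  \<open>K\<^sub>i(p y)\<close>. It is non-empty by compactness, and \<open>F\<close> has a closed graph because \<open>K\<^sub>i\<close> is closed and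
  lower semicontinuous (\<open>closed_upper_bounds_of_lsc_multimap\<close>). The values of \<open>F\<close> need not be convex,
  since \<open>u\<^sub>i(y, \<cdot>)\<close> need not be quasiconcave, but there is a point \<open>y\<close> with \<open>y \<in> co (F(y))\<close>
  (\<open>closed_correspondence_hull_fixed_point\<close>, a form of Kakutani's theorem). This is enough. The block
  \<open>y\<^sub>i\<close> is a convex combination of points of the convex set \<open>K\<^sub>i(p y)\<close>, so it belongs to it. If some
  \<open>w \<in> K\<^sub>i(p y)\<close> belonged to \<open>P\<^sub>i(y)\<close>, the maximum of \<open>u\<^sub>i(y, \<cdot>)\<close> would be positive, so all
  maximisers would lie in the convex set \<open>co (P\<^sub>i(y))\<close>, and hence so would \<open>y\<^sub>i\<close>, contrary to the
  irreflexivity hypothesis.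
\<close>

section \<open>A fixed point theorem for convex hulls of closed correspondences\<close>

text \<open>
  Were \<open>y\<close> never in \<open>co (F(y))\<close>, some linear functional \<open>a\<close> would strictly separate \<open>y\<close> from
  \<open>F(y)\<close>, and by closedness of the graph the same \<open>a\<close> would work near \<open>y\<close>. Finitely many such
  functionals, weighted by continuous functions, combine to a continuous vector field \<open>v\<close> with
  \<open>v y \<bullet> (z - y) > 0\<close> for all \<open>z \<in> F(y)\<close>. Brouwer's theorem forbids this.
\<close>
theorem closed_correspondence_hull_fixed_point:
  fixes F :: "'a::euclidean_space \<Rightarrow> 'a set"
  assumes S: "compact S" "convex S" "S \<noteq> {}"
    and ne: "\<And>y. y \<in> S \<Longrightarrow> F y \<noteq> {}"
    and sub: "\<And>y. y \<in> S \<Longrightarrow> F y \<subseteq> S"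
    and graph: "closed {(y, z). y \<in> S \<and> z \<in> F y}"
  shows "\<exists>y\<in>S. y \<in> convex hull (F y)"
proof (rule ccontr)
  assume no_fix: "\<not> ?thesis"
  define G where "G = {(y, z). y \<in> S \<and> z \<in> F y}"
  have "G = (S \<times> S) \<inter> G" using sub by (auto simp: G_def)
  then have G: "compact G"
    using graph compact_Int_closed[OF compact_Times[OF S(1) S(1)], of G] by (simp add: G_def)
  have compF: "compact (F y)" if "y \<in> S" for y
  proof -
    have "closed (Pair y -` G)"
      using compact_imp_closed[OF G] by (intro closed_vimage continuous_intros)
    moreover have "Pair y -` G = S \<inter> F y" using that sub by (auto simp: G_def)
    ultimately show ?thesis
      using sub[OF that] compact_Int_closed[OF S(1)] by (metis inf.absorb2 inf.left_idem)
  qed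
  \<comment> \<open>The points at which the direction \<open>a\<close> fails to lead from \<open>y\<close> towards all of \<open>F y\<close>.\<close>
  define C where "C a = {y. \<exists>z. (y, z) \<in> G \<and> a \<bullet> z \<le> a \<bullet> y}" for a
  have memC: "y \<in> C a \<longleftrightarrow> y \<in> S \<and> (\<exists>z\<in>F y. a \<bullet> z \<le> a \<bullet> y)" for y a
    by (simp add: C_def G_def Bex_def)
  have closedC: "closed (C a)" for a
  proof -
    have "closed {p :: 'a \<times> 'a. a \<bullet> snd p \<le> a \<bullet> fst p}"
      by (intro closed_Collect_le continuous_intros)
    then have "compact (G \<inter> {p. a \<bullet> snd p \<le> a \<bullet> fst p})"
      by (intro compact_Int_closed G)
    then have "compact (fst ` (G \<inter> {p. a \<bullet> snd p \<le> a \<bullet> fst p}))"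
      by (intro compact_continuous_image continuous_intros)
    moreover have "C a = fst ` (G \<inter> {p. a \<bullet> snd p \<le> a \<bullet> fst p})"
      unfolding C_def by (auto intro: image_eqI[of _ _ "(_, _)"])
    ultimately show ?thesis by (simp add: compact_imp_closed)
  qed
  have "S \<subseteq> \<Union> (range (\<lambda>a. - C a))"
  proof
    fix y assume y: "y \<in> S"
    have "closed (convex hull (F y))"
      using compF[OF y] by (intro compact_imp_closed compact_convex_hull)
    then obtain a c where "a \<bullet> y < c" "\<forall>x\<in>convex hull (F y). c < a \<bullet> x"
      using separating_hyperplane_closed_point[OF convex_convex_hull] no_fix y by metis
    then have "y \<notin> C a"
      using hull_subset[of "F y" convex] by (fastforce simp: memC)
    then show "y \<in> \<Union> (range (\<lambda>a. - C a))" by blast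
  qed
  then obtain D where D: "finite D" "S \<subseteq> (\<Union>a\<in>D. - C a)"
    using compactE_image[OF S(1), of UNIV "\<lambda>a. - C a"] closedC by (auto simp: open_Compl)
  \<comment> \<open>The weight of \<open>a\<close> vanishes exactly on \<open>C a\<close>. The distance to the empty set is \<open>0\<close> by
    convention, so that case is separate. The weights need not sum to \<open>1\<close>, as only the sign of
    \<open>v y \<bullet> (z - y)\<close> matters.\<close>
  define w where "w a y = (if C a = {} then 1 else infdist y (C a))" for a y
  have w_nonneg: "0 \<le> w a y" for a y by (simp add: w_def infdist_nonneg)
  have w_zero: "w a y = 0 \<longleftrightarrow> y \<in> C a" for a y
    using in_closed_iff_infdist_zero[OF closedC] by (auto simp: w_def)
  have w_cont: "continuous_on S (w a)" for a
    by (cases "C a = {}") (auto simp: w_def[abs_def] intro!: continuous_intros)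
  define v where "v y = (\<Sum>a\<in>D. w a y *\<^sub>R a)" for y
  have v_pos: "0 < v y \<bullet> (z - y)" if y: "y \<in> S" and z: "z \<in> F y" for y z
  proof -
    have pos: "0 < a \<bullet> (z - y)" if "y \<notin> C a" for a
      using that y z by (force simp: memC inner_diff_right)
    obtain a where a: "a \<in> D" "y \<notin> C a" using D y by blast
    have "0 < (\<Sum>a\<in>D. w a y * (a \<bullet> (z - y)))"
    proof (rule sum_pos2[OF D(1) a(1)])
      show "0 < w a y * (a \<bullet> (z - y))"
        using pos[OF a(2)] w_zero[of a y] w_nonneg[of a y] a(2) by (simp add: less_le)
      show "0 \<le> w i y * (i \<bullet> (z - y))" for i
        using pos[of i] w_zero[of i y] w_nonneg[of i y] by (cases "y \<in> C i") auto
    qed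
    then show ?thesis by (simp add: v_def inner_sum_left)
  qed
  \<comment> \<open>A fixed point of the projected field \<open>y \<mapsto> proj (y + v y)\<close> solves the variational
    inequality of \<open>v\<close> on \<open>S\<close>, which contradicts that \<open>v y\<close> points into \<open>F y \<subseteq> S\<close>.\<close>
  have "continuous_on S (\<lambda>y. closest_point S (y + v y))"
    unfolding v_def
    by (intro continuous_on_compose2[OF continuous_on_closest_point[of S UNIV]] continuous_intros w_cont)
       (use S compact_imp_closed in auto)
  moreover have "(\<lambda>y. closest_point S (y + v y)) \<in> S \<rightarrow> S"
    using S by (auto intro: closest_point_in_set compact_imp_closed)
  ultimately obtain y where y: "y \<in> S" "closest_point S (y + v y) = y"
    using brouwer[OF S] by blast
  obtain z where z: "z \<in> F y" using ne y by blast
  have "(y + v y - y) \<bullet> (z - y) \<le> 0"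
    using closest_point_dot[of S z "y + v y"] S compact_imp_closed sub y z by auto
  then show False using v_pos[OF y(1) z] by simp
qed

section \<open>Correspondences with open values and maximisation\<close>

text \<open>
  A ball of radius \<open>r\<close> around \<open>z0\<close> inside \<open>co (P(y0))\<close> forces \<open>P(y0)\<close> to reach beyond \<open>z0\<close> by more
  than \<open>r/2\<close> in every unit direction, and by compactness of the sphere finitely many points of
  \<open>P(y0)\<close> witness this. For \<open>y\<close> near \<open>y0\<close>, \<open>P(y)\<close> has points close to these finitely many, so no
  hyperplane can separate it from a point near \<open>z0\<close>.
\<close>
lemma openin_graph_convex_hull:
  fixes P :: "'a::topological_space \<Rightarrow> 'b::euclidean_space set"
  assumes lsc: "lsc_multimap Y UNIV P"
    and op: "\<And>y. y \<in> Y \<Longrightarrow> open (P y)"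
  shows "openin (top_of_set (Y \<times> UNIV)) {(y, z). y \<in> Y \<and> z \<in> convex hull (P y)}"
proof (subst openin_subopen, safe)
  fix y0 z0 assume y0: "y0 \<in> Y" and z0: "z0 \<in> convex hull (P y0)"
  have "open (convex hull (P y0))" using op[OF y0] by blast
  then obtain r where r: "0 < r" "cball z0 r \<subseteq> convex hull (P y0)"
    using z0 by (auto simp: open_contains_cball)
  have dir: "\<exists>p\<in>P y0. a \<bullet> z0 + r/2 < a \<bullet> p" if a: "norm a = 1" for a
  proof (rule ccontr)
    assume "\<not> ?thesis"
    then have "P y0 \<subseteq> {x. a \<bullet> x \<le> a \<bullet> z0 + r/2}" by (auto simp: not_less)
    then have "convex hull (P y0) \<subseteq> {x. a \<bullet> x \<le> a \<bullet> z0 + r/2}"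
      by (intro hull_minimal convex_halfspace_le)
    moreover have "z0 + r *\<^sub>R a \<in> cball z0 r" using a r by (simp add: dist_norm)
    ultimately have "a \<bullet> (z0 + r *\<^sub>R a) \<le> a \<bullet> z0 + r/2" using r by blast
    moreover have "a \<bullet> a = 1" using a by (simp add: dot_square_norm)
    ultimately show False using r by (simp add: inner_add_right)
  qed
  have "sphere 0 1 \<subseteq> (\<Union>p\<in>P y0. {a. a \<bullet> z0 + r/2 < a \<bullet> p})"
    using dir by (auto simp: dist_norm)
  moreover have "open {a. a \<bullet> z0 + r/2 < a \<bullet> p}" for p
    by (intro open_Collect_less continuous_intros)
  ultimately obtain S where S: "S \<subseteq> P y0" "finite S"
      "sphere 0 1 \<subseteq> (\<Union>p\<in>S. {a. a \<bullet> z0 + r/2 < a \<bullet> p})"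
    using compactE_image[OF compact_sphere, of "P y0" "\<lambda>p. {a. a \<bullet> z0 + r/2 < a \<bullet> p}" 0 1] by metis
  \<comment> \<open>The margin \<open>r/2\<close> has to absorb two errors: moving \<open>p\<close> to \<open>P y\<close> and moving \<open>z0\<close> to \<open>z\<close>.\<close>
  define e where "e = r/4"
  have e: "0 < e" using r by (simp add: e_def)
  define U where "U = Y \<inter> (\<Inter>p\<in>S. {y \<in> Y. P y \<inter> ball p e \<noteq> {}})"
  have U: "openin (top_of_set Y) U"
  proof (cases "S = {}")
    case False
    then show ?thesis
      unfolding U_def using lsc S(2)
      by (intro openin_Int openin_INT2) (auto simp: lsc_multimap_def)
  qed (simp add: U_def)
  have y0U: "y0 \<in> U" using y0 S(1) e by (auto simp: U_def)
  have "z \<in> convex hull (P y)" if y: "y \<in> U" and z: "z \<in> ball z0 e" for y z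
  proof (rule ccontr)
    assume nz: "z \<notin> convex hull (P y)"
    have "0 \<notin> (\<lambda>x. z - x) ` (convex hull (P y))" using nz by auto
    moreover have "convex ((\<lambda>x. z - x) ` (convex hull (P y)))"
      using convex_translation[OF convex_negations[OF convex_convex_hull], of z "P y"]
      by (simp add: image_image)
    ultimately obtain a0 where a0: "a0 \<noteq> 0" "\<And>x. x \<in> convex hull (P y) \<Longrightarrow> 0 \<le> a0 \<bullet> (z - x)"
      using separating_hyperplane_set_0 by (metis imageI)
    define a where "a = a0 /\<^sub>R norm a0"
    have a: "norm a = 1" using a0 by (simp add: a_def)
    have sep: "a \<bullet> x \<le> a \<bullet> z" if "x \<in> P y" for x
    proof -
      have "0 \<le> a0 \<bullet> (z - x)" using a0(2) that by (simp add: hull_inc)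
      then have "0 \<le> a \<bullet> (z - x)" by (simp add: a_def)
      then show ?thesis by (simp add: inner_diff_right)
    qed
    have close: "a \<bullet> u \<le> a \<bullet> u' + e" if "dist u u' < e" for u u'
      using norm_cauchy_schwarz[of a "u - u'"] a that by (simp add: inner_diff_right dist_norm)
    obtain p where p: "p \<in> S" "a \<bullet> z0 + r/2 < a \<bullet> p" using S(3) a by (force simp: dist_norm)
    obtain p' where p': "p' \<in> P y" "dist p p' < e" using y p(1) by (fastforce simp: U_def)
    show False
      using sep[OF p'(1)] close[OF p'(2)] close[of z z0] z p(2) by (simp add: e_def dist_commute)
  qed
  then have "U \<times> ball z0 e \<subseteq> {(y, z). y \<in> Y \<and> z \<in> convex hull (P y)}"
    by (auto simp: U_def)
  moreover have "openin (top_of_set (Y \<times> UNIV)) (U \<times> ball z0 e)"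
    by (intro openin_Times U) (auto simp: open_openin[symmetric])
  ultimately show "\<exists>T. openin (top_of_set (Y \<times> UNIV)) T \<and> (y0, z0) \<in> T \<and>
      T \<subseteq> {(y, z). y \<in> Y \<and> z \<in> convex hull (P y)}"
    using y0U e by (intro exI[of _ "U \<times> ball z0 e"]) auto
qed

text \<open>
  This gives the closed graph of a correspondence of maximisers: under lower semicontinuity, a point
  \<open>w\<close> of \<open>K(y)\<close> that beats \<open>z\<close> has neighbours in \<open>K(y')\<close> that still beat \<open>z'\<close> for \<open>(y', z')\<close> near
  \<open>(y, z)\<close>. This is the part of the maximum theorem of Berge that is needed.
\<close>
lemma closed_upper_bounds_of_lsc_multimap:
  fixes K :: "'a::topological_space \<Rightarrow> 'b::topological_space set"
    and f :: "'a \<times> 'b \<Rightarrow> real" and g :: "'a \<times> 'c::topological_space \<Rightarrow> real"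
  assumes Y: "closed Y" and KB: "multimap Y B K" and lsc: "lsc_multimap Y B K"
    and f: "continuous_on UNIV f" and g: "continuous_on UNIV g"
  shows "closed {(y, z). y \<in> Y \<and> (\<forall>w\<in>K y. f (y, w) \<le> g (y, z))}"
proof -
  let ?M = "{(y, z). y \<in> Y \<and> (\<exists>w\<in>K y. g (y, z) < f (y, w))}"
  have "openin (top_of_set (Y \<times> UNIV)) ?M"
  proof (subst openin_subopen, safe)
    fix y z w assume y: "y \<in> Y" and w: "w \<in> K y" and less: "g (y, z) < f (y, w)"
    obtain c where c: "g (y, z) < c" "c < f (y, w)" using dense[OF less] by blast
    have "open {q. c < f q}" by (intro open_Collect_less continuous_intros f)
    then obtain A1 B1 where
        1: "open A1" "open B1" "(y, w) \<in> A1 \<times> B1" "A1 \<times> B1 \<subseteq> {q. c < f q}"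
      by (rule open_prod_elim[of _ "(y, w)"]) (use c in auto)
    have "open {q. g q < c}" by (intro open_Collect_less continuous_intros g)
    then obtain A2 B2 where
        2: "open A2" "open B2" "(y, z) \<in> A2 \<times> B2" "A2 \<times> B2 \<subseteq> {q. g q < c}"
      by (rule open_prod_elim[of _ "(y, z)"]) (use c in auto)
    define U where "U = {y \<in> Y. K y \<inter> (B \<inter> B1) \<noteq> {}} \<inter> (Y \<inter> (A1 \<inter> A2))"
    have U: "openin (top_of_set Y) U"
      unfolding U_def using lsc 1 2 unfolding lsc_multimap_def
      by (intro openin_Int openin_open_Int) (auto intro!: openin_open_Int)
    have "U \<times> B2 \<subseteq> ?M"
    proof clarsimp
      fix y' z' assume y': "y' \<in> U" and z': "z' \<in> B2"
      then obtain w' where w': "w' \<in> K y'" "w' \<in> B1" by (auto simp: U_def)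
      have "c < f (y', w')" "g (y', z') < c" using y' z' w' 1(4) 2(4) by (auto simp: U_def)
      then show "y' \<in> Y \<and> (\<exists>w\<in>K y'. g (y', z') < f (y', w))"
        using w' y' by (auto simp: U_def intro!: bexI[of _ w'])
    qed
    moreover have "openin (top_of_set (Y \<times> UNIV)) (U \<times> B2)"
      using U 2 by (intro openin_Times) (auto simp: open_openin[symmetric])
    moreover have "w \<in> K y \<inter> (B \<inter> B1)" using y w 1 KB by (auto simp: multimap_def)
    then have "(y, z) \<in> U \<times> B2" using y 1 2 unfolding U_def by blast
    ultimately show "\<exists>T. openin (top_of_set (Y \<times> UNIV)) T \<and> (y, z) \<in> T \<and> T \<subseteq> ?M" by blast
  qed
  then have "closedin (top_of_set (Y \<times> UNIV)) (Y \<times> UNIV - ?M)"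
    by (simp add: closedin_diff)
  moreover have "Y \<times> UNIV - ?M = {(y, z). y \<in> Y \<and> (\<forall>w\<in>K y. f (y, w) \<le> g (y, z))}"
    by (auto simp: not_less)
  ultimately show ?thesis
    using closedin_closed_trans[OF _ closed_Times[OF Y closed_UNIV]] by simp
qed

section \<open>Products of blocks\<close>

lemma linear_block: "linear (block b i)"
  by (rule linearI) (auto simp: block_def vec_eq_iff)

lemma continuous_on_block [continuous_intros]:
  "continuous_on S f \<Longrightarrow> continuous_on S (\<lambda>x. block b i (f x))"
  using linear_continuous_on[OF linear_block[unfolded linear_conv_bounded_linear], of UNIV]
  by (rule continuous_on_compose2) auto

lemma block_in_block_space: "block b i y \<in> block_space b i"
  by (simp add: block_def block_space_def)

lemma block_idem: "v \<in> block_space b i \<Longrightarrow> block b i v = v"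
  by (auto simp: block_def block_space_def vec_eq_iff)

lemma closed_block_space: "closed (block_space b i)"
proof -
  have "block_space b i = {v. block b i v = v}"
    by (auto simp: block_def block_space_def vec_eq_iff)
  then show ?thesis by (simp add: closed_Collect_eq continuous_on_block continuous_on_id)
qed

lemma convex_block_prod:
  assumes "\<And>i. i \<in> \<Lambda> \<Longrightarrow> convex (S i)"
  shows "convex (block_prod b \<Lambda> S)"
proof -
  have "block_prod b \<Lambda> S = (\<Inter>i\<in>\<Lambda>. block b i -` S i)" by (auto simp: block_prod_def)
  then show ?thesis using assms by (auto intro!: convex_INT convex_linear_vimage linear_block)
qed

lemma compact_block_prod:
  assumes \<Lambda>: "\<And>k. b k \<in> \<Lambda>" "finite \<Lambda>" and S: "\<And>i. i \<in> \<Lambda> \<Longrightarrow> compact (S i)"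
  shows "compact (block_prod b \<Lambda> S)"
proof -
  have "closed (block b i -` S i)" if "i \<in> \<Lambda>" for i
    using S[OF that] by (intro closed_vimage compact_imp_closed continuous_intros)
  moreover have "block_prod b \<Lambda> S = (\<Inter>i\<in>\<Lambda>. block b i -` S i)" by (auto simp: block_prod_def)
  ultimately have "closed (block_prod b \<Lambda> S)" by auto
  moreover have "bounded (block_prod b \<Lambda> S)"
  proof -
    have "\<forall>i\<in>\<Lambda>. \<exists>B. \<forall>x\<in>S i. norm x \<le> B"
      using S compact_imp_bounded by (metis bounded_iff)
    then obtain B where B: "\<And>i x. i \<in> \<Lambda> \<Longrightarrow> x \<in> S i \<Longrightarrow> norm x \<le> B i" by metis
    have "norm y \<le> (\<Sum>i\<in>\<Lambda>. B i)" if y: "y \<in> block_prod b \<Lambda> S" for y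
    proof -
      have "y = (\<Sum>i\<in>\<Lambda>. block b i y)" using \<Lambda> by (simp add: block_def vec_eq_iff)
      then have "norm y \<le> (\<Sum>i\<in>\<Lambda>. norm (block b i y))" by (metis norm_sum)
      also have "\<dots> \<le> (\<Sum>i\<in>\<Lambda>. B i)"
        using y B by (intro sum_mono) (auto simp: block_prod_def)
      finally show ?thesis .
    qed
    then show ?thesis by (auto simp: bounded_iff)
  qed
  ultimately show ?thesis by (simp add: compact_eq_bounded_closed)
qed

lemma block_prod_choose:
  assumes \<Lambda>: "\<And>k. b k \<in> \<Lambda>" "finite \<Lambda>"
    and v: "\<And>i. i \<in> \<Lambda> \<Longrightarrow> v i \<in> S i" and S: "\<And>i. i \<in> \<Lambda> \<Longrightarrow> S i \<subseteq> block_space b i"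
  obtains z where "\<And>i. i \<in> \<Lambda> \<Longrightarrow> block b i z = v i" "z \<in> block_prod b \<Lambda> S"
proof (rule that)
  show *: "block b i (\<Sum>i\<in>\<Lambda>. v i) = v i" if "i \<in> \<Lambda>" for i
    using v S by (intro sum_block \<Lambda> that) blast
  show "(\<Sum>i\<in>\<Lambda>. v i) \<in> block_prod b \<Lambda> S"
    unfolding block_prod_def using * v by simp
qed

text \<open>
  Splitting \<open>V\<close> along the fibres of the projection exhibits its image as a union of slices of
  translates of \<open>V\<close>, one for each element of the kernel.
\<close>
lemma openin_image_block:
  assumes "open V"
  shows "openin (top_of_set (block_space b i)) (block b i ` V)"
proof -
  have "block b i ` V = (\<Union>c\<in>{c. block b i c = 0}. block_space b i \<inter> {w. w + c \<in> V})"
  proof safe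
    fix v assume "v \<in> V"
    moreover have "block b i (v - block b i v) = 0"
      by (simp add: block_def vec_eq_iff)
    ultimately show "block b i v \<in> (\<Union>c\<in>{c. block b i c = 0}. block_space b i \<inter> {w. w + c \<in> V})"
      using block_in_block_space by (auto intro!: exI[of _ "v - block b i v"])
  next
    fix c w assume "block b i c = 0" "w \<in> block_space b i" "w + c \<in> V"
    then show "w \<in> block b i ` V"
      by (intro image_eqI[of _ _ "w + c"]) (simp_all add: linear_add[OF linear_block] block_idem)
  qed
  moreover have "open {w. w + c \<in> V}" for c
    using assms continuous_open_vimage[of V "\<lambda>w. w + c"]
    by (auto simp: vimage_def intro!: continuous_intros)
  ultimately show ?thesis by (auto intro!: openin_open_Int)
qed

section \<open>Utilities representing the preferences\<close>

text \<open>
  The values of a preference are open only relative to the subspace of a block. Their preimages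
  under the projection are open in the whole space, keep lower semicontinuity, and have hulls with
  the same trace on the subspace, so the result on open graphs applies to them.
\<close>
lemma lsc_multimap_vimage_block:
  assumes "lsc_multimap A (block_space b i) P"
  shows "lsc_multimap A UNIV (\<lambda>y. block b i -` P y)"
proof -
  have *: "{y \<in> A. block b i -` P y \<inter> V \<noteq> {}} = {y \<in> A. P y \<inter> block b i ` V \<noteq> {}}" for V
    by auto
  have "openin (top_of_set A) {y \<in> A. P y \<inter> block b i ` V \<noteq> {}}" if "open V" for V
    using assms openin_image_block[OF that, of b i] unfolding lsc_multimap_def by blast
  then show ?thesis
    by (simp only: lsc_multimap_def * subtopology_UNIV open_openin[symmetric]) simp
qed

lemma lsc_multimap_compose:
  assumes "lsc_multimap A B K" "continuous_on Y p" "p \<in> Y \<rightarrow> A"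
  shows "lsc_multimap Y B (\<lambda>y. K (p y))"
proof -
  have *: "{y \<in> Y. K (p y) \<inter> V \<noteq> {}} = Y \<inter> p -` {x \<in> A. K x \<inter> V \<noteq> {}}" for V
    using assms(3) by auto
  show ?thesis
    using assms(1) continuous_openin_preimage[OF assms(2,3)]
    unfolding lsc_multimap_def * by blast
qed

lemma hull_vimage_block:
  assumes P: "P \<subseteq> block_space b i" and v: "v \<in> block_space b i"
  shows "v \<in> convex hull (block b i -` P) \<longleftrightarrow> v \<in> convex hull P"
proof
  assume "v \<in> convex hull (block b i -` P)"
  then have "block b i v \<in> convex hull (block b i ` (block b i -` P))"
    using convex_hull_linear_image[OF linear_block] by blast
  moreover have "block b i ` (block b i -` P) \<subseteq> P" by auto
  ultimately show "v \<in> convex hull P"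
    using hull_mono block_idem[OF v] by (metis subsetD)
next
  have "P \<subseteq> block b i -` P" using P block_idem by fastforce
  then show "v \<in> convex hull P \<Longrightarrow> v \<in> convex hull (block b i -` P)"
    using hull_mono by blast
qed

text \<open>
  The utility is the distance to \<open>Y \<times> UNIV - ?G\<close>, the complement of the graph of the hulls.
  Irreflexivity makes this complement non-empty, without which the distance would be
  \<open>0\<close> everywhere.
\<close>
lemma preference_utility:
  assumes Y: "closed Y" "Y \<noteq> {}"
    and P: "multimap Y (block_space b i) P" and lsc: "lsc_multimap Y (block_space b i) P"
    and op: "\<And>y. y \<in> Y \<Longrightarrow> openin (top_of_set (block_space b i)) (P y)"
    and irr: "\<And>y. y \<in> Y \<Longrightarrow> block b i y \<notin> convex hull (P y)"
  obtains u :: "(real^'k) \<times> (real^'k) \<Rightarrow> real"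
  where "continuous_on UNIV u"
    "\<And>y z. y \<in> Y \<Longrightarrow> z \<in> block_space b i \<Longrightarrow> 0 < u (y, z) \<longleftrightarrow> z \<in> convex hull (P y)"
proof -
  define Q where "Q y = block b i -` P y" for y
  have QP: "z \<in> convex hull (Q y) \<longleftrightarrow> z \<in> convex hull (P y)"
    if "y \<in> Y" "z \<in> block_space b i" for y z
    unfolding Q_def using hull_vimage_block that P by (metis multimap_def)
  have opQ: "open (Q y)" if "y \<in> Y" for y
  proof -
    obtain T where T: "open T" "P y = block_space b i \<inter> T"
      using op[OF \<open>y \<in> Y\<close>] by (auto simp: openin_open)
    then have "Q y = block b i -` T" by (auto simp: Q_def block_in_block_space)
    then show ?thesis
      using T by (auto intro!: open_vimage continuous_intros)
  qed
  let ?G = "{(y, z). y \<in> Y \<and> z \<in> convex hull (Q y)}"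
  have "openin (top_of_set (Y \<times> UNIV)) ?G"
    using lsc_multimap_vimage_block[OF lsc] opQ
    by (intro openin_graph_convex_hull) (auto simp: Q_def[abs_def])
  then have "closedin (top_of_set (Y \<times> UNIV)) (Y \<times> UNIV - ?G)"
    by (simp add: closedin_diff)
  then have C: "closed (Y \<times> UNIV - ?G)"
    by (rule closedin_closed_trans[OF _ closed_Times[OF Y(1) closed_UNIV]])
  obtain y0 where y0: "y0 \<in> Y" using Y by blast
  have "(y0, block b i y0) \<in> Y \<times> UNIV - ?G"
    using y0 irr QP block_in_block_space by blast
  then have ne: "Y \<times> UNIV - ?G \<noteq> {}" by blast
  show ?thesis
  proof (rule that[of "\<lambda>q. infdist q (Y \<times> UNIV - ?G)"])
    show "continuous_on UNIV (\<lambda>q. infdist q (Y \<times> UNIV - ?G))"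
      by (intro continuous_intros)
    fix y z assume y: "y \<in> Y" and z: "z \<in> block_space b i"
    have "0 < infdist (y, z) (Y \<times> UNIV - ?G) \<longleftrightarrow> (y, z) \<notin> Y \<times> UNIV - ?G"
      using in_closed_iff_infdist_zero[OF C ne, of "(y, z)"]
        infdist_nonneg[of "(y, z)" "Y \<times> UNIV - ?G"] by linarith
    then show "0 < infdist (y, z) (Y \<times> UNIV - ?G) \<longleftrightarrow> z \<in> convex hull (P y)"
      using y QP[OF y z] by simp
  qed
qed

section \<open>Projected solutions\<close>

theorem theorem4p1:
  fixes N :: nat
    and n :: "nat \<Rightarrow> nat"
    and b :: "'k::finite \<Rightarrow> nat"
    and \<Lambda> :: "nat set"
    and X :: "nat \<Rightarrow> (real^'k) set"
    and K P :: "nat \<Rightarrow> real^'k \<Rightarrow> (real^'k) set"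
    and XX :: "(real^'k) set"
    and KK :: "real^'k \<Rightarrow> (real^'k) set"
  assumes Lambda: "\<Lambda> = {1..N}"
    and blocks: "\<And>k. b k \<in> \<Lambda>"
    and dims: "\<And>i. i \<in> \<Lambda> \<Longrightarrow> 1 \<le> n i \<and> card {k. b k = i} = n i"
    and XX: "XX = block_prod b \<Lambda> X"
    and KK: "\<And>x. x \<in> XX \<Longrightarrow> KK x = block_prod b \<Lambda> (\<lambda>i. K i x)"
    and X_sub: "\<And>i. i \<in> \<Lambda> \<Longrightarrow> X i \<subseteq> block_space b i"
    and K_map: "\<And>i. i \<in> \<Lambda> \<Longrightarrow> multimap XX (block_space b i) (K i)"
    and P_map: "\<And>i. i \<in> \<Lambda> \<Longrightarrow> multimap UNIV (block_space b i) (P i)"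
    and hyp_a: "\<And>i. i \<in> \<Lambda> \<Longrightarrow> X i \<noteq> {} \<and> compact (X i) \<and> convex (X i)"
    and hyp_b: "\<And>i. i \<in> \<Lambda> \<Longrightarrow>
          closed_multimap XX (block_space b i) (K i) \<and>
          lsc_multimap XX (block_space b i) (K i) \<and>
          (\<forall>x\<in>XX. K i x \<noteq> {} \<and> convex (K i x))"
    and hyp_c: "\<And>i. i \<in> \<Lambda> \<Longrightarrow> lsc_multimap UNIV (block_space b i) (P i)"
    and hyp_d: "\<And>i y. i \<in> \<Lambda> \<Longrightarrow>
          y \<in> block_prod b \<Lambda> (\<lambda>j. convex hull (closure (\<Union>x\<in>XX. K j x))) \<Longrightarrow>
          openin (top_of_set (block_space b i)) (P i y) \<and> block b i y \<notin> convex hull (P i y)"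
    and rel_compact: "compact (closure (\<Union>x\<in>XX. KK x))"
  shows "\<exists>x. projected_solution b \<Lambda> X K P x"
proof -
  let ?V = "block_space b"
  have fin: "finite \<Lambda>" using Lambda by simp
  note choose = block_prod_choose[where b = b and \<Lambda> = \<Lambda>, OF blocks fin]
  have XXc: "compact XX" "convex XX"
    unfolding XX using hyp_a blocks fin by (auto intro!: compact_block_prod convex_block_prod)
  obtain x0 where x0: "x0 \<in> XX"
  proof -
    have "\<forall>i\<in>\<Lambda>. \<exists>a. a \<in> X i" using hyp_a by blast
    then obtain a where "\<And>i. i \<in> \<Lambda> \<Longrightarrow> a i \<in> X i" by metis
    then show ?thesis
      by (rule choose[of a X]) (use X_sub that XX in blast)+
  qed
  have K_sub: "K i x \<subseteq> ?V i" if "i \<in> \<Lambda>" "x \<in> XX" for i x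
    using K_map[OF that(1)] that(2) by (simp add: multimap_def)
  define R where "R i = (\<Union>x\<in>XX. K i x)" for i
  \<comment> \<open>As no factor of the product \<open>K x\<close> is empty, every point of \<open>K\<^sub>i(x)\<close> extends to a point of
    \<open>K x\<close>. Hence boundedness of \<open>K(X)\<close> passes to \<open>K\<^sub>i(X)\<close>.\<close>
  have R_bdd: "compact (closure (R i))" if i: "i \<in> \<Lambda>" for i
  proof -
    have "R i \<subseteq> block b i ` closure (\<Union>x\<in>XX. KK x)"
    proof
      fix v assume "v \<in> R i"
      then obtain x where x: "x \<in> XX" "v \<in> K i x" by (auto simp: R_def)
      have "\<forall>j\<in>\<Lambda>. \<exists>a. a \<in> K j x \<and> (j = i \<longrightarrow> a = v)" using hyp_b x by blast
      then obtain a where a: "\<And>j. j \<in> \<Lambda> \<Longrightarrow> a j \<in> K j x" "a i = v" using i by metis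
      obtain z where "\<And>j. j \<in> \<Lambda> \<Longrightarrow> block b j z = a j" "z \<in> block_prod b \<Lambda> (\<lambda>j. K j x)"
        by (rule choose[of a "\<lambda>j. K j x"]) (use K_sub x(1) a(1) in blast)+
      then have "block b i z = v" "z \<in> block_prod b \<Lambda> (\<lambda>j. K j x)" using a(2) i by auto
      then have "z \<in> closure (\<Union>x\<in>XX. KK x)"
        using KK[OF x(1)] x(1) closure_subset[of "\<Union>x\<in>XX. KK x"] by blast
      then show "v \<in> block b i ` closure (\<Union>x\<in>XX. KK x)"
        using \<open>block b i z = v\<close> by blast
    qed
    moreover have "bounded (block b i ` closure (\<Union>x\<in>XX. KK x))"
      using compact_imp_bounded[OF rel_compact] linear_block
      by (intro bounded_linear_image) (simp_all add: linear_conv_bounded_linear)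
    ultimately have "bounded (R i)" by (rule bounded_subset[rotated])
    then show ?thesis by simp
  qed
  define Y where "Y = block_prod b \<Lambda> (\<lambda>j. convex hull (closure (R j)))"
  have Y: "compact Y" "convex Y"
    unfolding Y_def
    by (rule compact_block_prod[OF blocks fin compact_convex_hull[OF R_bdd]], assumption)
      (rule convex_block_prod[OF convex_convex_hull])
  have Ksub: "block_prod b \<Lambda> (\<lambda>i. K i x) \<subseteq> Y" if "x \<in> XX" for x
  proof -
    have "K i x \<subseteq> convex hull (closure (R i))" for i
      using that hull_subset[of "closure (R i)" convex] closure_subset[of "R i"]
      by (auto simp: R_def)
    then show ?thesis by (auto simp: Y_def block_prod_def)
  qed
  have d: "openin (top_of_set (?V i)) (P i y) \<and> block b i y \<notin> convex hull (P i y)"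
    if "i \<in> \<Lambda>" "y \<in> Y" for i y
    using hyp_d[OF that(1), of y] that(2) unfolding Y_def R_def by blast
  have XX_closed: "closed XX" using XXc(1) by (rule compact_imp_closed)
  have Kgraph: "closed {(x, v). x \<in> XX \<and> v \<in> K i x}" if "i \<in> \<Lambda>" for i
  proof -
    have "closedin (top_of_set (XX \<times> ?V i)) {(x, v). x \<in> XX \<and> v \<in> K i x}"
      using hyp_b[OF that] by (simp add: closed_multimap_def)
    then show ?thesis
      by (rule closedin_closed_trans[OF _ closed_Times[OF XX_closed closed_block_space]])
  qed
  have Kcomp: "compact (K i x)" if "i \<in> \<Lambda>" "x \<in> XX" for i x
  proof -
    have "closed (Pair x -` {(x, v). x \<in> XX \<and> v \<in> K i x})"
      by (intro closed_vimage Kgraph[OF that(1)] continuous_intros)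
    moreover have "Pair x -` {(x, v). x \<in> XX \<and> v \<in> K i x} = K i x" using that by auto
    ultimately have "closed (K i x)" by simp
    moreover have "K i x \<subseteq> R i" using that(2) by (auto simp: R_def)
    then have "closure (R i) \<inter> K i x = K i x" using closure_subset[of "R i"] by blast
    ultimately show ?thesis using compact_Int_closed[OF R_bdd[OF that(1)], of "K i x"] by simp
  qed
  have Kne: "\<exists>z. z \<in> block_prod b \<Lambda> (\<lambda>i. K i x)" if x: "x \<in> XX" for x
  proof -
    have "\<forall>i\<in>\<Lambda>. \<exists>a. a \<in> K i x" using hyp_b x by blast
    then obtain a where "\<And>i. i \<in> \<Lambda> \<Longrightarrow> a i \<in> K i x" by metis
    then show ?thesis
      by (rule choose[of a "\<lambda>i. K i x"]) (use K_sub x in blast)+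
  qed
  have Y_ne: "Y \<noteq> {}" using Kne Ksub x0 by blast
  define p where "p = closest_point XX"
  have p_in: "p y \<in> XX" for y
    unfolding p_def using closest_point_in_set[OF XX_closed] x0 by blast
  have p_cont: "continuous_on S p" for S
    unfolding p_def using continuous_on_closest_point[OF XXc(2) XX_closed] x0 by blast
  have "\<forall>i\<in>\<Lambda>. \<exists>u :: (real^'k) \<times> (real^'k) \<Rightarrow> real. continuous_on UNIV u \<and>
      (\<forall>y z. y \<in> Y \<longrightarrow> z \<in> ?V i \<longrightarrow> (0 < u (y, z) \<longleftrightarrow> z \<in> convex hull (P i y)))"
  proof
    fix i assume i: "i \<in> \<Lambda>"
    have "multimap Y (?V i) (P i)" using P_map[OF i] by (simp add: multimap_def)
    moreover have "lsc_multimap Y (?V i) (P i)"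
      using lsc_multimap_compose[OF hyp_c[OF i], of Y "\<lambda>y. y"] by simp
    ultimately obtain v :: "(real^'k) \<times> (real^'k) \<Rightarrow> real" where "continuous_on UNIV v"
        "\<And>y z. y \<in> Y \<Longrightarrow> z \<in> ?V i \<Longrightarrow> 0 < v (y, z) \<longleftrightarrow> z \<in> convex hull (P i y)"
      by (rule preference_utility[OF compact_imp_closed[OF Y(1)] Y_ne]) (use d[OF i] in blast)+
    then show "\<exists>u :: (real^'k) \<times> (real^'k) \<Rightarrow> real. continuous_on UNIV u \<and>
      (\<forall>y z. y \<in> Y \<longrightarrow> z \<in> ?V i \<longrightarrow> (0 < u (y, z) \<longleftrightarrow> z \<in> convex hull (P i y)))"
      by blast
  qed
  then obtain u :: "nat \<Rightarrow> (real^'k) \<times> (real^'k) \<Rightarrow> real" where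
      u_cont: "\<And>i. i \<in> \<Lambda> \<Longrightarrow> continuous_on UNIV (u i)" and
      u_pos: "\<And>i y z. i \<in> \<Lambda> \<Longrightarrow> y \<in> Y \<Longrightarrow> z \<in> ?V i \<Longrightarrow> 0 < u i (y, z) \<longleftrightarrow> z \<in> convex hull (P i y)"
    by metis
  \<comment> \<open>Each player \<open>i\<close> maximises \<open>u i (y, _)\<close> over the constraint set at the projection of \<open>y\<close>.\<close>
  define F where "F y = block_prod b \<Lambda>
      (\<lambda>i. {v \<in> K i (p y). \<forall>w\<in>K i (p y). u i (y, w) \<le> u i (y, v)})" for y
  have F_mem: "z \<in> F y \<longleftrightarrow> (\<forall>i\<in>\<Lambda>. block b i z \<in> K i (p y) \<and>
      (\<forall>w\<in>K i (p y). u i (y, w) \<le> u i (y, block b i z)))" for y z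
    by (simp add: F_def block_prod_def)
  have F_sub: "F y \<subseteq> Y" for y
    using Ksub[OF p_in[of y]] by (auto simp: F_def block_prod_def)
  have F_ne: "F y \<noteq> {}" for y
  proof -
    have "\<forall>i\<in>\<Lambda>. \<exists>v\<in>K i (p y). \<forall>w\<in>K i (p y). u i (y, w) \<le> u i (y, v)"
    proof
      fix i assume i: "i \<in> \<Lambda>"
      have "continuous_on (K i (p y)) (\<lambda>w. u i (y, w))"
        by (rule continuous_on_compose2[OF u_cont[OF i]]) (auto intro!: continuous_intros)
      then show "\<exists>v\<in>K i (p y). \<forall>w\<in>K i (p y). u i (y, w) \<le> u i (y, v)"
        using continuous_attains_sup[OF Kcomp[OF i p_in]] hyp_b[OF i] p_in by blast
    qed
    then obtain v where v: "\<And>i. i \<in> \<Lambda> \<Longrightarrow> v i \<in> K i (p y)"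
        "\<And>i w. i \<in> \<Lambda> \<Longrightarrow> w \<in> K i (p y) \<Longrightarrow> u i (y, w) \<le> u i (y, v i)"
      by metis
    obtain z where "\<And>i. i \<in> \<Lambda> \<Longrightarrow> block b i z = v i"
      by (rule choose[of v "\<lambda>i. K i (p y)"]) (use K_sub[OF _ p_in[of y]] v(1) in blast)+
    then have "z \<in> F y" using v by (simp add: F_mem)
    then show ?thesis by blast
  qed
  have F_graph: "closed {(y, z). y \<in> Y \<and> z \<in> F y}"
  proof -
    let ?A = "\<lambda>i. {q. (p (fst q), block b i (snd q)) \<in> {(x, v). x \<in> XX \<and> v \<in> K i x}}"
    let ?M = "\<lambda>i. {(y, z). y \<in> Y \<and> (\<forall>w\<in>K i (p y). u i (y, w) \<le> u i (y, block b i z))}"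
    have A: "closed (?A i)" if "i \<in> \<Lambda>" for i
      using Kgraph[OF that] unfolding vimage_def[symmetric]
      by (rule closed_vimage)
        (intro continuous_on_Pair continuous_on_block continuous_on_compose2[OF p_cont[of UNIV]]
          continuous_on_fst continuous_on_snd continuous_on_id subset_UNIV)
    have M: "closed (?M i)" if i: "i \<in> \<Lambda>" for i
    proof -
      have "lsc_multimap Y (?V i) (\<lambda>y. K i (p y))"
        using hyp_b[OF i] p_in by (intro lsc_multimap_compose[OF _ p_cont]) auto
      moreover have "multimap Y (?V i) (\<lambda>y. K i (p y))"
        using K_sub[OF i p_in] by (simp add: multimap_def)
      moreover have "continuous_on UNIV (\<lambda>(y, z). u i (y, block b i z))"
        unfolding case_prod_beta
        by (rule continuous_on_compose2[OF u_cont[OF i]]) (auto intro!: continuous_intros)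
      ultimately show ?thesis
        using closed_upper_bounds_of_lsc_multimap[of Y "?V i" "\<lambda>y. K i (p y)" "u i"
            "\<lambda>(y, z). u i (y, block b i z)"] Y(1) u_cont[OF i]
        by (simp add: compact_imp_closed)
    qed
    have YU: "closed (Y \<times> (UNIV :: (real^'k) set))"
      by (rule closed_Times[OF compact_imp_closed[OF Y(1)] closed_UNIV])
    have "{(y, z). y \<in> Y \<and> z \<in> F y} = Y \<times> UNIV \<inter> (\<Inter>i\<in>\<Lambda>. ?A i \<inter> ?M i)"
      using p_in by (auto simp: F_mem)
    then show ?thesis by (simp only:) (intro closed_Int YU closed_INT ballI A M)
  qed
  have "\<exists>y\<in>Y. y \<in> convex hull (F y)"
    by (rule closed_correspondence_hull_fixed_point[OF Y Y_ne _ _ F_graph]) (rule F_ne F_sub)+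
  then obtain y where y: "y \<in> Y" "y \<in> convex hull (F y)" by blast
  \<comment> \<open>Projecting onto a block is linear, so it commutes with convex hulls.\<close>
  have block_y: "block b i y \<in> convex hull (block b i ` F y)" for i
    using y convex_hull_linear_image[OF linear_block] by blast
  have "block b i y \<in> K i (p y)" if i: "i \<in> \<Lambda>" for i
  proof -
    have "convex hull (block b i ` F y) \<subseteq> K i (p y)"
      using hyp_b[OF i] p_in i by (intro hull_minimal) (auto simp: F_mem)
    then show ?thesis using block_y by blast
  qed
  moreover have "P i y \<inter> K i (p y) = {}" if i: "i \<in> \<Lambda>" for i
  proof (rule ccontr)
    assume "P i y \<inter> K i (p y) \<noteq> {}"
    then obtain w where w: "w \<in> P i y" "w \<in> K i (p y)" by blast
    have "0 < u i (y, w)"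
      using u_pos[OF i y(1), of w] hull_inc[OF w(1), of convex] w(2) K_sub[OF i p_in[of y]] by blast
    have "block b i ` F y \<subseteq> convex hull (P i y)"
    proof
      fix v assume "v \<in> block b i ` F y"
      then have v: "v \<in> ?V i" "u i (y, w) \<le> u i (y, v)"
        using i w block_in_block_space by (auto simp: F_mem)
      then show "v \<in> convex hull (P i y)"
        using u_pos[OF i y(1) v(1)] \<open>0 < u i (y, w)\<close> by simp
    qed
    then have "convex hull (block b i ` F y) \<subseteq> convex hull (P i y)"
      by (intro hull_minimal convex_convex_hull)
    then show False using block_y d[OF i y(1)] by blast
  qed
  moreover have "norm (y - p y) = (INF w\<in>XX. norm (y - w))"
  proof (rule sym, rule cInf_eq_minimum)
    show "norm (y - p y) \<in> (\<lambda>w. norm (y - w)) ` XX" using p_in by blast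
    show "norm (y - p y) \<le> r" if "r \<in> (\<lambda>w. norm (y - w)) ` XX" for r
      using that closest_point_le[OF compact_imp_closed[OF XXc(1)], of _ y]
      by (auto simp: p_def dist_norm)
  qed
  ultimately have "projected_solution b \<Lambda> X K P (p y)"
    using p_in unfolding projected_solution_def XX by blast
  then show ?thesis by blast
qed

end
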